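(* Let $Z$ be a complex space with Kobayashi pseudo-distance $d_Z$. Let $(\Omega,\mu)$ be a probability space, $T:\Omega\to\Omega$ an ergodic measure-preserving map, and $\varphi$ a map from $\Omega$ to holomorphic self-maps of $Z$ such that the cocycle $u(n,\omega)=\varphi(\omega)\varphi(T\omega)\cdots\varphi(T^{n-1}\omega)$ satisfies: for every $z\in Z$ and $n$ the map $\omega\mapsto u(n,\omega)z$ is measurable, and $\int_\Omega d_Z(z,\varphi(\omega)z)\,d\mu<\infty$ for some (equivalently all) $z$. Then for a.e. $\omega$ there is a metric functional $h^\omega$ of the pseudo-metric space $(Z,d_Z)$ such that for all $z\in Z$ $$\lim_{n\to\infty}-\frac1n h^\omega(u(n,\omega)z)=\tau:=\lim_{n\to\infty}\frac1n d_Z(u(n,\omega)z,z).$$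
   Context: Fix a base point $z_0\in Z$; for $z\in Z$ let $h_z(\cdot)=d_Z(\cdot,z)-d_Z(z_0,z)$. Endow $\mathbb{R}^Z$ with the topology of pointwise convergence. A metric functional of $(Z,d_Z)$ is an element of the closure of $\{h_z:z\in Z\}$ in $\mathbb{R}^Z$. Holomorphic maps are 1-Lipschitz for the Kobayashi pseudo-distance. *)

theory Defs
  imports "HOL-Probability.Probability"
begin

definition pseudo_metric :: "('z \<Rightarrow> 'z \<Rightarrow> real) \<Rightarrow> bool" where
  "pseudo_metric d \<longleftrightarrow> (\<forall>x y. 0 \<le> d x y) \<and> (\<forall>x. d x x = 0) \<and> (\<forall>x y. d x y = d y x)
     \<and> (\<forall>x y z. d x z \<le> d x y + d y z)"

definition pm_open :: "('z \<Rightarrow> 'z \<Rightarrow> real) \<Rightarrow> 'z set \<Rightarrow> bool" where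
  "pm_open d U \<longleftrightarrow> (\<forall>x\<in>U. \<exists>e>0. {y. d x y < e} \<subseteq> U)"

definition pm_borel :: "('z \<Rightarrow> 'z \<Rightarrow> real) \<Rightarrow> 'z measure" where
  "pm_borel d = sigma UNIV {U. pm_open d U}"

definition measure_preserving_map :: "'w measure \<Rightarrow> ('w \<Rightarrow> 'w) \<Rightarrow> bool" where
  "measure_preserving_map M T \<longleftrightarrow> T \<in> M \<rightarrow>\<^sub>M M \<and>
     (\<forall>A\<in>sets M. emeasure M (T -` A \<inter> space M) = emeasure M A)"

definition ergodic_map :: "'w measure \<Rightarrow> ('w \<Rightarrow> 'w) \<Rightarrow> bool" where
  "ergodic_map M T \<longleftrightarrow> measure_preserving_map M T \<and>
     (\<forall>A\<in>sets M. T -` A \<inter> space M = A \<longrightarrow> emeasure M A = 0 \<or> emeasure M A = 1)"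

fun cocycle :: "('w \<Rightarrow> 'w) \<Rightarrow> ('w \<Rightarrow> 'z \<Rightarrow> 'z) \<Rightarrow> nat \<Rightarrow> 'w \<Rightarrow> 'z \<Rightarrow> 'z" where
  "cocycle T \<phi> 0 w = id"
| "cocycle T \<phi> (Suc n) w = cocycle T \<phi> n w \<circ> \<phi> ((T ^^ n) w)"

text \<open>Metric functionals: pointwise closure (product topology on 'z => real) of
  the functions h_z = d(.,z) - d(z0,z).\<close>
definition metric_functionals :: "('z \<Rightarrow> 'z \<Rightarrow> real) \<Rightarrow> 'z \<Rightarrow> ('z \<Rightarrow> real) set" where
  "metric_functionals d z0 = closure (range (\<lambda>z. \<lambda>x. d x z - d z0 z))"

end

theory Submission
  imports Defs
begin

text \<open>
  Put \<open>v n w = d (u n w z0) z0\<close>, a nonnegative subadditive cocycle, and let \<open>rate\<close> be the infimum of the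
  means of \<open>v n / n\<close>. Following Gouezel and Karlsson, almost every \<open>w\<close> has infinitely many good times
  \<open>n\<close>, at which \<open>v n w - v (n - l) ((T ^^ l) w) \<ge> (rate - \<epsilon>\<^sub>l) * l\<close> for all \<open>l \<le> n\<close>, with
  \<open>\<epsilon>\<^sub>l\<close> tending to \<open>0\<close>. As the maps \<open>u l w\<close> are nonexpansive, \<open>h z = d z y - d z0 y\<close> with
  \<open>y = u n w z0\<close> then satisfies \<open>h (u l w z0) \<le> - (rate - \<epsilon>\<^sub>l) * l\<close>, and this passes to a
  pointwise cluster point along the good times.

  That bad times have small density is a counting argument. Sample a residue class modulo \<open>s\<close> of times.
  Each bad time sits at the end of a stretch on which the cocycle, recentred by \<open>rate\<close>, falls at
  speed \<open>\<epsilon>\<close>; outside these stretches it rises by at most the positive part of \<open>v s - rate * s\<close> per step.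
  This positive part has mean \<open>o(s)\<close> by the pointwise ergodic theorem and Fatou's lemma, whereas the
  recentred cocycle has nonnegative mean, so there is no room for many bad times. Only \<open>l\<close> that are
  multiples of \<open>s\<close> are controlled in this way (\<open>s\<close> depending on \<open>\<epsilon>\<close>); the others follow at the end because
  \<open>h\<close> is 1-Lipschitz and \<open>v r ((T ^^ (n - r)) w) = o(n)\<close>.
\<close>

section \<open>The pointwise ergodic theorem\<close>

locale ergodic_system = prob_space M for M :: "'w measure" +
  fixes T :: "'w \<Rightarrow> 'w"
  assumes ergodic: "ergodic_map M T"
begin

lemma measurable_T [measurable]: "T \<in> M \<rightarrow>\<^sub>M M"
  using ergodic by (simp add: ergodic_map_def measure_preserving_map_def)

lemma measurable_T_pow [measurable]: "T ^^ n \<in> M \<rightarrow>\<^sub>M M"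
  by (rule measurable_compose_n) simp

lemma T_pow_space: "w \<in> space M \<Longrightarrow> (T ^^ n) w \<in> space M"
  using measurable_T_pow[of n] by (auto simp: measurable_def)

lemma T_space: "w \<in> space M \<Longrightarrow> T w \<in> space M"
  using T_pow_space[of w 1] by simp

lemma distr_T: "distr M M T = M"
  using ergodic
  by (intro measure_eqI) (auto simp: ergodic_map_def measure_preserving_map_def emeasure_distr)

lemma distr_T_pow: "distr M M (T ^^ n) = M"
proof (induction n)
  case 0
  show ?case using distr_id2[of M M] by (simp add: id_def)
next
  case (Suc n)
  have "distr M M (T ^^ Suc n) = distr (distr M M (T ^^ n)) M T"
    by (subst distr_distr) simp_all
  then show ?case by (simp only: Suc distr_T)
qed

lemma integrable_T_pow:
  fixes f :: "'w \<Rightarrow> real"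
  assumes "integrable M f"
  shows "integrable M (\<lambda>w. f ((T ^^ n) w))"
  using integrable_distr[OF measurable_T_pow, of n f] assms by (simp add: distr_T_pow)

lemma integral_T_pow:
  fixes f :: "'w \<Rightarrow> real"
  assumes [measurable]: "f \<in> borel_measurable M"
  shows "(\<integral>w. f ((T ^^ n) w) \<partial>M) = (\<integral>w. f w \<partial>M)"
  using integral_distr[OF measurable_T_pow assms, of n] by (simp add: distr_T_pow)

lemma integrable_comp_T:
  fixes f :: "'w \<Rightarrow> real"
  shows "integrable M f \<Longrightarrow> integrable M (\<lambda>w. f (T w))"
  using integrable_T_pow[of f 1] by simp

section \<open>Birkhoff sums and their running maxima\<close>

definition birkhoff_sum :: "('w \<Rightarrow> real) \<Rightarrow> nat \<Rightarrow> 'w \<Rightarrow> real" where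
  "birkhoff_sum f n w = (\<Sum>i<n. f ((T ^^ i) w))"

lemma birkhoff_sum_Suc_shift: "birkhoff_sum f (Suc n) w = f w + birkhoff_sum f n (T w)"
  unfolding birkhoff_sum_def by (subst sum.lessThan_Suc_shift) (simp add: funpow_swap1)

lemma birkhoff_sum_Suc: "birkhoff_sum f (Suc n) w = birkhoff_sum f n w + f ((T ^^ n) w)"
  unfolding birkhoff_sum_def by simp

lemma measurable_birkhoff_sum [measurable]:
  "f \<in> borel_measurable M \<Longrightarrow> birkhoff_sum f n \<in> borel_measurable M"
  unfolding birkhoff_sum_def[abs_def]
  by (intro borel_measurable_sum measurable_compose[OF measurable_T_pow])

lemma integrable_birkhoff_sum: "integrable M f \<Longrightarrow> integrable M (birkhoff_sum f n)"
  unfolding birkhoff_sum_def[abs_def] by (intro Bochner_Integration.integrable_sum integrable_T_pow)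

lemma integral_birkhoff_sum:
  "integrable M f \<Longrightarrow> (\<integral>w. birkhoff_sum f n w \<partial>M) = n * (\<integral>w. f w \<partial>M)"
  unfolding birkhoff_sum_def[abs_def]
  by (subst Bochner_Integration.integral_sum)
     (auto intro: integrable_T_pow simp: integral_T_pow borel_measurable_integrable)

text \<open>The largest of the Birkhoff sums of length at most \<open>n\<close>, the empty sum
  included. Splitting off the first point makes the difference from
  \<open>running_max g n (T w)\<close> a simple maximum.\<close>

primrec running_max :: "('w \<Rightarrow> real) \<Rightarrow> nat \<Rightarrow> 'w \<Rightarrow> real" where
  "running_max g 0 w = 0"
| "running_max g (Suc n) w = max 0 (g w + running_max g n (T w))"

lemma integrable_running_max: "integrable M g \<Longrightarrow> integrable M (running_max g n)"
proof (induction n)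
  case 0
  have "running_max g 0 = (\<lambda>_. 0)" by auto
  then show ?case by simp
next
  case (Suc n)
  have "running_max g (Suc n) = (\<lambda>w. max 0 (g w + running_max g n (T w)))" by auto
  then show ?case
    using Suc integrable_comp_T[of "running_max g n"] by simp
qed

lemma running_max_mono: "m \<le> n \<Longrightarrow> running_max g m w \<le> running_max g n w"
proof -
  have "running_max g n w \<le> running_max g (Suc n) w" for n
  proof (induction n arbitrary: w)
    case (Suc n)
    show ?case using Suc[of "T w"] by (simp add: max_def)
  qed simp
  then show "m \<le> n \<Longrightarrow> running_max g m w \<le> running_max g n w"
    by (rule lift_Suc_mono_le)
qed

lemma birkhoff_sum_le_running_max: "birkhoff_sum g n w \<le> running_max g n w"
proof (induction n arbitrary: w)
  case (Suc n)
  show ?case using Suc[of "T w"] by (simp add: birkhoff_sum_Suc_shift)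
qed (simp add: birkhoff_sum_def)

lemma running_max_nonneg: "0 \<le> running_max g n w"
  using running_max_mono[of 0 n] by simp

text \<open>The set where the Birkhoff sums are unbounded is invariant. If it had full measure, then
  \<open>running_max g (Suc n) - running_max g n \<circ> T\<close>, whose mean is nonnegative, would converge to \<open>g\<close>.\<close>
lemma AE_birkhoff_sum_bdd_above:
  assumes g: "integrable M g" and neg: "(\<integral>w. g w \<partial>M) < 0"
  shows "AE w in M. bdd_above (range (\<lambda>n. birkhoff_sum g n w))"
proof -
  have [measurable]: "g \<in> borel_measurable M" using g by auto
  define B where "B = {w \<in> space M. \<forall>c::nat. \<exists>n. birkhoff_sum g n w > c}"
  have B [measurable]: "B \<in> sets M" unfolding B_def by measurable
  have B_iff: "w \<in> B \<longleftrightarrow> w \<in> space M \<and> \<not> bdd_above (range (\<lambda>n. birkhoff_sum g n w))" for w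
  proof -
    have "bdd_above (range (\<lambda>n. birkhoff_sum g n w)) \<longleftrightarrow> (\<exists>c::nat. \<forall>n. birkhoff_sum g n w \<le> c)"
    proof
      assume "bdd_above (range (\<lambda>n. birkhoff_sum g n w))"
      then obtain C where C: "\<And>n. birkhoff_sum g n w \<le> C" by (auto simp: bdd_above_def)
      obtain c :: nat where "C \<le> c" using real_arch_simple by blast
      with C show "\<exists>c::nat. \<forall>n. birkhoff_sum g n w \<le> c" by (meson order_trans)
    qed (auto simp: bdd_above_def)
    then show ?thesis by (auto simp: B_def not_less not_le)
  qed
  have inv: "T -` B \<inter> space M = B"
  proof -
    have "bdd_above (range (\<lambda>n. birkhoff_sum g n (T w))) \<longleftrightarrow>
        bdd_above (range (\<lambda>n. birkhoff_sum g n w))" for w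
    proof
      assume "bdd_above (range (\<lambda>n. birkhoff_sum g n (T w)))"
      then obtain C where C: "\<And>n. birkhoff_sum g n (T w) \<le> C" by (auto simp: bdd_above_def)
      have "birkhoff_sum g n w \<le> max 0 (g w + C)" for n
      proof (cases n)
        case (Suc m)
        then show ?thesis using C[of m] by (simp add: birkhoff_sum_Suc_shift)
      qed (simp add: birkhoff_sum_def)
      then show "bdd_above (range (\<lambda>n. birkhoff_sum g n w))" by (auto simp: bdd_above_def)
    next
      assume "bdd_above (range (\<lambda>n. birkhoff_sum g n w))"
      then obtain C where C: "\<And>n. birkhoff_sum g n w \<le> C" by (auto simp: bdd_above_def)
      have "birkhoff_sum g n (T w) \<le> C - g w" for n
        using C[of "Suc n"] by (simp add: birkhoff_sum_Suc_shift)
      then show "bdd_above (range (\<lambda>n. birkhoff_sum g n (T w)))" by (auto simp: bdd_above_def)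
    qed
    then show ?thesis by (auto simp: B_iff T_space)
  qed
  have "emeasure M B \<noteq> 1"
  proof
    assume "emeasure M B = 1"
    then have AEB: "AE w in M. w \<in> B" by (simp add: emeasure_eq_measure prob_eq_1)
    \<comment> \<open>Since running maxima are nonnegative, this form gives
      \<open>\<bar>F n w\<bar> \<le> \<bar>g w\<bar>\<close>, and \<open>F n w = g w\<close> once
      \<open>running_max g n (T w)\<close> reaches \<open>- g w\<close>.\<close>
    define F where "F n w = max (- running_max g n (T w)) (g w)" for n w
    have F: "F n w = running_max g (Suc n) w - running_max g n (T w)" for n w
      unfolding F_def by (simp add: max_def)
    have rm [measurable]: "running_max g n \<in> borel_measurable M" for n
      using integrable_running_max[OF g] by auto
    have F_nonneg: "0 \<le> (\<integral>w. F n w \<partial>M)" for n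
    proof -
      have "(\<integral>w. F n w \<partial>M) = (\<integral>w. running_max g (Suc n) w \<partial>M) - (\<integral>w. running_max g n (T w) \<partial>M)"
        unfolding F
        by (intro Bochner_Integration.integral_diff integrable_running_max integrable_comp_T g)
      also have "(\<integral>w. running_max g n (T w) \<partial>M) = (\<integral>w. running_max g n w \<partial>M)"
        using integral_T_pow[of "running_max g n" 1] by simp
      also have "(\<integral>w. running_max g (Suc n) w \<partial>M) - \<dots> \<ge> 0"
        using integral_mono[OF integrable_running_max[OF g] integrable_running_max[OF g],
            of n "Suc n"] running_max_mono[of n "Suc n" g] by (simp del: running_max.simps)
      finally show ?thesis .
    qed
    have "(\<lambda>n. \<integral>w. F n w \<partial>M) \<longlonglongrightarrow> (\<integral>w. g w \<partial>M)"
    proof (rule integral_dominated_convergence[where w = "\<lambda>w. \<bar>g w\<bar>"])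
      show "AE w in M. (\<lambda>n. F n w) \<longlonglongrightarrow> g w"
        using AEB
      proof eventually_elim
        case (elim w)
        then have "T w \<in> B" using inv by auto
        then have "\<exists>n. - g w < birkhoff_sum g n (T w)"
          by (auto simp: B_iff bdd_above_def not_le)
        then obtain n where n: "- g w < birkhoff_sum g n (T w)" by blast
        have "F m w = g w" if "n \<le> m" for m
          using n birkhoff_sum_le_running_max[of g n "T w"] running_max_mono[OF that, of g "T w"]
          by (simp add: F_def)
        then show ?case
          by (intro tendsto_eventually) (auto simp: eventually_sequentially)
      qed
      show "AE w in M. norm (F n w) \<le> \<bar>g w\<bar>" for n
      proof (intro AE_I2)
        show "norm (F n w) \<le> \<bar>g w\<bar>" for w
          using running_max_nonneg[of g n "T w"] by (simp add: F_def)
      qed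
      show "F n \<in> borel_measurable M" for n
        unfolding F_def[abs_def] by measurable
      show "integrable M (\<lambda>w. \<bar>g w\<bar>)"
        using g by (rule integrable_abs)
    qed measurable
    then have "0 \<le> (\<integral>w. g w \<partial>M)"
      by (rule LIMSEQ_le_const) (use F_nonneg in auto)
    with neg show False by simp
  qed
  moreover have "emeasure M B = 0 \<or> emeasure M B = 1"
    using ergodic B inv unfolding ergodic_map_def by blast
  ultimately have "emeasure M B = 0" by blast
  then have "AE w in M. w \<notin> B"
    by (intro AE_not_in) (auto simp: null_sets_def)
  then show ?thesis
    by (rule AE_mp) (auto simp: B_iff)
qed

text \<open>The function \<open>f - c\<close> has negative mean, so its Birkhoff sums are almost
  everywhere bounded above.\<close>

lemma birkhoff_upper:
  assumes f: "integrable M f" and c: "(\<integral>w. f w \<partial>M) < c"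
  shows "AE w in M. \<exists>C. \<forall>n. birkhoff_sum f n w \<le> c * n + C"
proof -
  have "(\<integral>w. f w - c \<partial>M) < 0" using f c by (simp add: prob_space)
  with f have "AE w in M. bdd_above (range (\<lambda>n. birkhoff_sum (\<lambda>w. f w - c) n w))"
    by (intro AE_birkhoff_sum_bdd_above) auto
  then show ?thesis
  proof eventually_elim
    case (elim w)
    then obtain C where C: "\<And>n. birkhoff_sum (\<lambda>w. f w - c) n w \<le> C" by (auto simp: bdd_above_def)
    have "birkhoff_sum f n w \<le> c * n + C" for n
      using C[of n] by (simp add: birkhoff_sum_def sum_subtractf algebra_simps)
    then show ?case by blast
  qed
qed

text \<open>Division by \<open>n\<close> removes the constant of \<open>birkhoff_upper\<close>; the
  countably many slopes indexed by \<open>j\<close> yield one null set for all real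
  \<open>c\<close>.\<close>

lemma birkhoff_limsup:
  assumes f: "integrable M f"
  shows "AE w in M. \<forall>c > (\<integral>w. f w \<partial>M). \<forall>\<^sub>F n in sequentially. birkhoff_sum f n w / n < c"
proof -
  have "AE w in M. \<forall>j::nat. \<exists>C. \<forall>n. birkhoff_sum f n w \<le> ((\<integral>w. f w \<partial>M) + inverse (Suc j)) * n + C"
    using birkhoff_upper[OF f] by (subst AE_all_countable) simp
  then show ?thesis
  proof eventually_elim
    case (elim w)
    show ?case
    proof (intro allI impI)
      fix c assume "(\<integral>w. f w \<partial>M) < c"
      then obtain j where j: "inverse (real (Suc j)) < c - (\<integral>w. f w \<partial>M)"
        using reals_Archimedean[of "c - (\<integral>w. f w \<partial>M)"] by auto
      define b where "b = (\<integral>w. f w \<partial>M) + inverse (Suc j)"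
      obtain C where C: "\<And>n. birkhoff_sum f n w \<le> b * n + C" using elim unfolding b_def by blast
      have "(\<lambda>n. C / real n) \<longlonglongrightarrow> 0" by (rule lim_const_over_n)
      moreover have "0 < c - b" using j by (simp add: b_def)
      ultimately have "\<forall>\<^sub>F n in sequentially. C / real n < c - b" by (rule order_tendstoD)
      then show "\<forall>\<^sub>F n in sequentially. birkhoff_sum f n w / n < c"
        using eventually_gt_at_top[of 0]
      proof eventually_elim
        case (elim n)
        have "birkhoff_sum f n w / n \<le> (b * n + C) / n"
          using C by (intro divide_right_mono) auto
        also have "\<dots> = b + C / n" using elim by (simp add: field_simps)
        also have "\<dots> < c" using elim by simp
        finally show ?case .
      qed
    qed
  qed
qed

text \<open>The upper bound for \<open>- f\<close> is the lower bound for \<open>f\<close>.\<close>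

lemma birkhoff:
  assumes f: "integrable M f"
  shows "AE w in M. (\<lambda>n. birkhoff_sum f n w / n) \<longlonglongrightarrow> (\<integral>w. f w \<partial>M)"
proof -
  have neg: "birkhoff_sum (\<lambda>w. - f w) n w = - birkhoff_sum f n w" for n w
    by (simp add: birkhoff_sum_def sum_negf)
  have "AE w in M. \<forall>c > (\<integral>w. - f w \<partial>M). \<forall>\<^sub>F n in sequentially. birkhoff_sum (\<lambda>w. - f w) n w / n < c"
    using f by (intro birkhoff_limsup) simp
  with birkhoff_limsup[OF f] show ?thesis
  proof eventually_elim
    case (elim w)
    show ?case
    proof (rule order_tendstoI)
      fix a assume "a < (\<integral>w. f w \<partial>M)"
      then have "\<forall>\<^sub>F n in sequentially. birkhoff_sum (\<lambda>w. - f w) n w / n < - a"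
        using elim(2) by simp
      then show "\<forall>\<^sub>F n in sequentially. a < birkhoff_sum f n w / n"
        by eventually_elim (simp add: neg)
    qed (use elim(1) in auto)
  qed
qed

text \<open>A single orbit term is the difference of consecutive Birkhoff sums, whose averages share
  a limit.\<close>

lemma AE_T_pow_over_n:
  fixes f :: "'w \<Rightarrow> real"
  assumes f: "integrable M f"
  shows "AE w in M. (\<lambda>n. f ((T ^^ n) w) / n) \<longlonglongrightarrow> 0"
  using birkhoff[OF f]
proof eventually_elim
  case (elim w)
  let ?a = "\<lambda>n. birkhoff_sum f n w / real n"
  have "(\<lambda>n. ?a (Suc n) * (real (Suc n) / real n) - ?a n) \<longlonglongrightarrow> (\<integral>w. f w \<partial>M) * 1 - (\<integral>w. f w \<partial>M)"
    by (intro tendsto_intros LIMSEQ_Suc elim LIMSEQ_Suc_n_over_n)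
  moreover have "\<forall>\<^sub>F n in sequentially. ?a (Suc n) * (real (Suc n) / real n) - ?a n = f ((T ^^ n) w) / n"
    using eventually_gt_at_top[of 0]
    by eventually_elim (simp add: birkhoff_sum_Suc field_simps del: of_nat_Suc)
  ultimately show ?case by (simp add: tendsto_cong)
qed

end

section \<open>Subadditive cocycles\<close>

locale subadditive_cocycle = ergodic_system M T for M :: "'w measure" and T +
  fixes v :: "nat \<Rightarrow> 'w \<Rightarrow> real"
  assumes v_measurable [measurable]: "\<And>n. v n \<in> borel_measurable M"
    and v_1_integrable: "integrable M (v 1)"
    and v_nonneg: "\<And>n w. w \<in> space M \<Longrightarrow> 0 \<le> v n w"
    and v_0: "\<And>w. w \<in> space M \<Longrightarrow> v 0 w = 0"
    and v_subadd: "\<And>m n w. w \<in> space M \<Longrightarrow> v (m + n) w \<le> v m w + v n ((T ^^ m) w)"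
begin

lemma v_le_birkhoff_sum: "w \<in> space M \<Longrightarrow> v n w \<le> birkhoff_sum (v 1) n w"
proof (induction n)
  case (Suc n)
  then show ?case using v_subadd[of w n 1] by (simp add: birkhoff_sum_Suc)
qed (simp add: v_0 birkhoff_sum_def)

lemma v_integrable: "integrable M (v n)"
proof (rule Bochner_Integration.integrable_bound[OF integrable_birkhoff_sum[OF v_1_integrable]])
  show "AE w in M. norm (v n w) \<le> norm (birkhoff_sum (v 1) n w)"
    using v_le_birkhoff_sum v_nonneg by (intro AE_I2) (fastforce intro: order_trans[OF _ abs_ge_self])
qed simp

text \<open>By Fekete's lemma this is also the limit of the quotients. The infimum gives directly
  what is used later: \<open>rate_le\<close> for every \<open>n\<close> and
  \<open>rate_approx\<close> for some \<open>s\<close>.\<close>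

definition rate :: real where
  "rate = (INF n\<in>{1..}. (\<integral>w. v n w \<partial>M) / real n)"

lemma bdd_below_rate: "bdd_below ((\<lambda>n. (\<integral>w. v n w \<partial>M) / real n) ` {1..})"
  by (intro bdd_belowI[of _ 0]) (auto intro!: divide_nonneg_nonneg Bochner_Integration.integral_nonneg_AE v_nonneg)

lemma rate_nonneg: "0 \<le> rate"
  unfolding rate_def
  by (intro cINF_greatest) (auto intro!: divide_nonneg_nonneg Bochner_Integration.integral_nonneg_AE v_nonneg)

lemma rate_le: "rate * n \<le> (\<integral>w. v n w \<partial>M)"
proof (cases "n = 0")
  case True
  then show ?thesis by (auto intro!: Bochner_Integration.integral_nonneg_AE v_nonneg)
next
  case False
  then have "rate \<le> (\<integral>w. v n w \<partial>M) / real n"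
    unfolding rate_def by (intro cINF_lower bdd_below_rate) auto
  with False show ?thesis by (simp add: field_simps)
qed

lemma rate_approx:
  assumes "rate < c"
  obtains s where "1 \<le> s" "(\<integral>w. v s w \<partial>M) / real s < c"
  using assms cINF_less_iff[OF _ bdd_below_rate, of c] unfolding rate_def by auto

section \<open>Almost sure upper bound for the growth of the cocycle\<close>

lemma v_le_blocks:
  assumes w: "w \<in> space M"
  shows "v (i + q * s) w \<le> v i w + (\<Sum>j<q. v s ((T ^^ (i + j * s)) w))"
proof (induction q)
  case (Suc q)
  have "v (i + Suc q * s) w = v ((i + q * s) + s) w" by (simp add: algebra_simps)
  also have "\<dots> \<le> v (i + q * s) w + v s ((T ^^ (i + q * s)) w)" by (rule v_subadd[OF w])
  finally show ?case using Suc by simp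
qed simp

text \<open>The pair \<open>(i, j)\<close> can be recovered from \<open>i + j * s\<close> because
  \<open>i < s\<close>, and the block of length \<open>s\<close> starting there fits below
  \<open>n\<close>; hence no term is used twice.\<close>

lemma sum_residue_classes_le:
  fixes f :: "nat \<Rightarrow> real"
  assumes "\<And>m. 0 \<le> f m"
  shows "(\<Sum>i<s. \<Sum>j<(n - i) div s. f (i + j * s)) \<le> (\<Sum>m<n. f m)"
proof -
  let ?I = "Sigma {..<s} (\<lambda>i. {..<(n - i) div s})"
  have inj: "inj_on (\<lambda>(i, j). i + j * s) ?I"
  proof (rule inj_onI, clarsimp)
    fix i j i' j' assume *: "i < s" "i' < s" "i + j * s = i' + j' * s"
    have "i mod s = i' mod s" using *(3) by (metis mod_mult_self1)
    then have "i = i'" using * by simp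
    with * show "i = i' \<and> j = j'" by simp
  qed
  have sub: "(\<lambda>(i, j). i + j * s) ` ?I \<subseteq> {..<n}"
  proof clarsimp
    fix i j assume "i < s" "j < (n - i) div s"
    then have "Suc j * s \<le> n - i" by (metis Suc_leI div_times_less_eq_dividend mult_le_mono1 order_trans)
    then show "i + j * s < n" using \<open>i < s\<close> by simp
  qed
  have "(\<Sum>i<s. \<Sum>j<(n - i) div s. f (i + j * s)) = (\<Sum>(i, j)\<in>?I. f (i + j * s))"
    by (rule sum.Sigma) auto
  also have "\<dots> = sum f ((\<lambda>(i, j). i + j * s) ` ?I)"
    by (subst sum.reindex[OF inj]) (simp add: case_prod_unfold comp_def)
  also have "\<dots> \<le> (\<Sum>m<n. f m)"
    by (rule sum_mono2[OF _ sub]) (auto simp: assms)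
  finally show ?thesis .
qed

text \<open>\<open>T ^^ s\<close> need not be ergodic, so blocks cut from one fixed start would give
  sums without a known limit. Summing over all \<open>s\<close> offsets turns them into a Birkhoff
  sum for \<open>T\<close> itself, up to boundary terms.\<close>

lemma v_le_offset_average:
  assumes w: "w \<in> space M" and n: "s \<le> n" and s: "1 \<le> s"
  shows "s * v n w \<le> birkhoff_sum (v s) n w
    + s * ((\<Sum>i<s. v i w) + (\<Sum>r<s. v r ((T ^^ (n - r)) w)))"
proof -
  let ?D = "(\<Sum>i<s. v i w)" and ?R = "(\<Sum>r<s. v r ((T ^^ (n - r)) w))"
  have "v n w \<le> ?D + ?R + (\<Sum>j<(n - i) div s. v s ((T ^^ (i + j * s)) w))" if i: "i < s" for i
  proof -
    \<comment> \<open>The segment splits into \<open>i\<close> initial steps, \<open>q\<close>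
      blocks of length \<open>s\<close> and a remainder \<open>r\<close>. The outer pieces are
      bounded by \<open>?D\<close> and \<open>?R\<close>, which do not depend on
      \<open>i\<close>.\<close>
    define q r where "q = (n - i) div s" and "r = (n - i) mod s"
    have r: "r < s" using s by (simp add: r_def)
    have n_eq: "n = (i + q * s) + r" using i n by (simp add: q_def r_def)
    have "v n w \<le> v (i + q * s) w + v r ((T ^^ (i + q * s)) w)"
      using v_subadd[OF w, of "i + q * s" r] n_eq by simp
    also have "i + q * s = n - r" using n_eq by simp
    also have "v r ((T ^^ (n - r)) w) \<le> ?R"
      using r by (intro member_le_sum) (auto intro: v_nonneg T_pow_space w)
    finally have "v n w \<le> v (n - r) w + ?R" by simp
    moreover have "v (n - r) w \<le> v i w + (\<Sum>j<q. v s ((T ^^ (i + j * s)) w))"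
      using v_le_blocks[OF w, of i q s] n_eq by simp
    moreover have "v i w \<le> ?D"
      using i by (intro member_le_sum) (auto intro: v_nonneg w)
    ultimately show ?thesis by (simp add: q_def)
  qed
  then have "(\<Sum>i<s. v n w) \<le> (\<Sum>i<s. ?D + ?R + (\<Sum>j<(n - i) div s. v s ((T ^^ (i + j * s)) w)))"
    by (intro sum_mono) auto
  also have "\<dots> = s * (?D + ?R) + (\<Sum>i<s. \<Sum>j<(n - i) div s. v s ((T ^^ (i + j * s)) w))"
    by (simp add: sum.distrib)
  also have "(\<Sum>i<s. \<Sum>j<(n - i) div s. v s ((T ^^ (i + j * s)) w)) \<le> birkhoff_sum (v s) n w"
    unfolding birkhoff_sum_def
    by (rule sum_residue_classes_le) (auto intro: v_nonneg T_pow_space w)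
  finally show ?thesis by simp
qed

text \<open>These are the boundary terms at the end of an orbit segment. Offsetting by
  \<open>r\<close> undoes the truncated subtraction, and the larger denominator only helps.\<close>

lemma AE_v_shift_over_n: "AE w in M. \<forall>r. (\<lambda>n. v r ((T ^^ (n - r)) w) / n) \<longlonglongrightarrow> 0"
proof -
  have "AE w in M. \<forall>r. (\<lambda>n. v r ((T ^^ n) w) / n) \<longlonglongrightarrow> 0"
    using AE_T_pow_over_n[OF v_integrable] by (simp add: AE_all_countable)
  with AE_space show ?thesis
  proof eventually_elim
    case (elim w)
    show ?case
    proof (rule allI, rule LIMSEQ_offset)
      fix r
      show "(\<lambda>n. v r ((T ^^ (n + r - r)) w) / (n + r)) \<longlonglongrightarrow> 0"
      proof (rule Lim_null_comparison)
        show "\<forall>\<^sub>F n in sequentially. norm (v r ((T ^^ (n + r - r)) w) / (n + r)) \<le> v r ((T ^^ n) w) / n"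
          using eventually_gt_at_top[of 0]
          by eventually_elim (auto simp: v_nonneg T_pow_space elim intro!: divide_left_mono)
      qed (use elim in auto)
    qed
  qed
qed

lemma AE_v_upper_const:
  assumes c: "rate < c"
  shows "AE w in M. \<forall>\<^sub>F n in sequentially. v n w / n < c"
proof -
  obtain s where s: "1 \<le> s" and sc: "(\<integral>w. v s w \<partial>M) / real s < c"
    using rate_approx[OF c] by blast
  from birkhoff[OF v_integrable[of s]] AE_space AE_v_shift_over_n show ?thesis
  proof eventually_elim
    case (elim w)
    \<comment> \<open>The bound of \<open>v_le_offset_average\<close> divided by
      \<open>s * n\<close>; only its first term survives in the limit, and \<open>s\<close> was
      chosen to make that limit smaller than \<open>c\<close>.\<close>
    define b where "b n = birkhoff_sum (v s) n w / n / s
        + ((\<Sum>i<s. v i w) / n + (\<Sum>r<s. v r ((T ^^ (n - r)) w) / n))" for n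
    have "b \<longlonglongrightarrow> (\<integral>w. v s w \<partial>M) / s + (0 + (\<Sum>r<s. 0))"
      unfolding b_def using s by (intro tendsto_intros elim(1) elim(3)[rule_format] lim_const_over_n) auto
    then have "\<forall>\<^sub>F n in sequentially. b n < c"
      using sc by (intro order_tendstoD) auto
    then show ?case
      using eventually_ge_at_top[of s]
    proof eventually_elim
      case (elim n)
      have "s * v n w / (s * n) \<le> (birkhoff_sum (v s) n w
        + s * ((\<Sum>i<s. v i w) + (\<Sum>r<s. v r ((T ^^ (n - r)) w)))) / (s * n)"
        using \<open>w \<in> space M\<close> elim s by (intro divide_right_mono v_le_offset_average) auto
      also have "\<dots> = b n"
        using elim s by (simp add: b_def field_simps sum_divide_distrib[symmetric])
      finally have "v n w / n \<le> b n" using s by simp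
      with elim show ?case by simp
    qed
  qed
qed

lemma AE_v_upper: "AE w in M. \<forall>c>rate. \<forall>\<^sub>F n in sequentially. v n w / n < c"
proof -
  have "AE w in M. \<forall>j::nat. \<forall>\<^sub>F n in sequentially. v n w / n < rate + inverse (Suc j)"
    by (subst AE_all_countable) (auto intro!: AE_v_upper_const)
  then show ?thesis
  proof eventually_elim
    case (elim w)
    show ?case
    proof (intro allI impI)
      fix c assume "rate < c"
      then obtain j where j: "inverse (real (Suc j)) < c - rate"
        using reals_Archimedean[of "c - rate"] by auto
      from elim have "\<forall>\<^sub>F n in sequentially. v n w / n < rate + inverse (Suc j)" by blast
      then show "\<forall>\<^sub>F n in sequentially. v n w / n < c"
        by eventually_elim (use j in linarith)
    qed
  qed
qed

text \<open>Bounds the rise of \<open>v n - rate * n\<close> when \<open>s\<close> steps are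
  prepended. Truncation at 0 supplies the nonnegative increments that \<open>card_drops_le\<close>
  asks for.\<close>

definition excess :: "nat \<Rightarrow> 'w \<Rightarrow> real" where
  "excess s w = max 0 (v s w - rate * s)"

lemma excess_nonneg: "0 \<le> excess s w"
  by (simp add: excess_def)

lemma excess_measurable [measurable]: "excess s \<in> borel_measurable M"
  unfolding excess_def[abs_def] by measurable

lemma excess_integrable: "integrable M (excess s)"
  unfolding excess_def[abs_def] by (intro integrable_max) (auto intro: v_integrable)

text \<open>Fatou's lemma for the nonnegative functions \<open>birkhoff_sum (v 1) n / n - excess n / n\<close>,
  which converge to the mean of \<open>v 1\<close>.\<close>
lemma excess_small:
  fixes \<theta> :: real
  assumes \<theta>: "0 < \<theta>"
  obtains s where "1 \<le> s" "(\<integral>w. excess s w \<partial>M) \<le> \<theta> * s"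
proof -
  have "\<exists>s\<ge>1. (\<integral>w. excess s w \<partial>M) \<le> \<theta> * s"
  proof (rule ccontr)
    assume neg: "\<not> ?thesis"
    define m where "m = (\<integral>w. v 1 w \<partial>M)"
    define X where "X n w = birkhoff_sum (v 1) n w / n - excess n w / n" for n w
    have [measurable]: "X n \<in> borel_measurable M" for n
      unfolding X_def[abs_def] by measurable
    have X_int: "integrable M (X n)" for n
      unfolding X_def[abs_def]
      by (intro Bochner_Integration.integrable_diff integrable_divide excess_integrable
          integrable_birkhoff_sum v_1_integrable)
    have X_nonneg: "0 \<le> X n w" if "w \<in> space M" for n w
    proof -
      have "excess n w \<le> birkhoff_sum (v 1) n w"
        using v_le_birkhoff_sum[OF that, of n] v_nonneg[OF that, of n]
          mult_nonneg_nonneg[OF rate_nonneg of_nat_0_le_iff[of n]]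
        unfolding excess_def by linarith
      then show ?thesis by (simp add: X_def divide_right_mono)
    qed
    have X_le: "(\<integral>w. X n w \<partial>M) \<le> m - \<theta>" if "1 \<le> n" for n
    proof -
      have "(\<integral>w. X n w \<partial>M) = m - (\<integral>w. excess n w \<partial>M) / n"
        unfolding X_def using that
        by (subst Bochner_Integration.integral_diff)
           (auto intro: integrable_divide excess_integrable integrable_birkhoff_sum v_1_integrable[simplified]
             simp: integral_birkhoff_sum[OF v_1_integrable[simplified]] m_def)
      moreover have "\<theta> \<le> (\<integral>w. excess n w \<partial>M) / n"
      proof -
        have "\<not> (\<integral>w. excess n w \<partial>M) \<le> \<theta> * n" using neg that by blast
        then show ?thesis using that by (simp add: field_simps)
      qed
      ultimately show ?thesis by simp
    qed
    have X_lim: "AE w in M. (\<lambda>n. X n w) \<longlonglongrightarrow> m"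
      using birkhoff[OF v_1_integrable] AE_v_upper
    proof eventually_elim
      case (elim w)
      have "(\<lambda>n. excess n w / n) \<longlonglongrightarrow> 0"
      proof (rule order_tendstoI)
        fix a :: real assume a: "a < 0"
        have "0 \<le> excess n w / n" for n by (simp add: excess_nonneg)
        with a show "\<forall>\<^sub>F n in sequentially. a < excess n w / n"
          by (intro always_eventually allI) (rule less_le_trans)
      next
        fix a :: real assume a: "0 < a"
        then have "\<forall>\<^sub>F n in sequentially. v n w / n < rate + a" using elim by simp
        then show "\<forall>\<^sub>F n in sequentially. excess n w / n < a"
          using eventually_gt_at_top[of 0]
          by eventually_elim (use a in \<open>auto simp: excess_def field_simps max_def\<close>)
      qed
      then have "(\<lambda>n. X n w) \<longlonglongrightarrow> m - 0"
        unfolding X_def m_def by (intro tendsto_diff elim)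
      then show ?case by simp
    qed
    \<comment> \<open>The index \<open>Suc n\<close> skips 0, where division by zero makes
      \<open>X\<close> vanish and \<open>X_le\<close> says nothing.\<close>
    have "ennreal m = (\<integral>\<^sup>+ w. liminf (\<lambda>n. ennreal (X (Suc n) w)) \<partial>M)"
    proof -
      have "AE w in M. liminf (\<lambda>n. ennreal (X (Suc n) w)) = ennreal m"
        using X_lim
      proof eventually_elim
        case (elim w)
        then have "(\<lambda>n. ennreal (X (Suc n) w)) \<longlonglongrightarrow> ennreal m"
          by (intro tendsto_ennrealI LIMSEQ_Suc)
        then show ?case by (intro lim_imp_Liminf) auto
      qed
      then have "(\<integral>\<^sup>+ w. liminf (\<lambda>n. ennreal (X (Suc n) w)) \<partial>M) = (\<integral>\<^sup>+ w. ennreal m \<partial>M)"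
        by (rule nn_integral_cong_AE)
      then show ?thesis by (simp add: emeasure_space_1)
    qed
    also have "\<dots> \<le> liminf (\<lambda>n. \<integral>\<^sup>+ w. ennreal (X (Suc n) w) \<partial>M)"
      by (rule nn_integral_liminf) measurable
    also have "\<dots> \<le> ennreal (m - \<theta>)"
    proof (rule Liminf_le)
      show "\<forall>\<^sub>F n in sequentially. (\<integral>\<^sup>+ w. ennreal (X (Suc n) w) \<partial>M) \<le> ennreal (m - \<theta>)"
        using X_le X_nonneg
        by (intro always_eventually allI, subst nn_integral_eq_integral[OF X_int])
           (auto intro!: ennreal_leI)
    qed simp
    finally have "ennreal m \<le> ennreal (m - \<theta>)" .
    \<comment> \<open>\<open>ennreal\<close> sends negative reals to 0, so the comparison of reals
      needs this sign.\<close>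
    moreover have "0 \<le> m - \<theta>"
    proof -
      have "0 \<le> (\<integral>w. X 1 w \<partial>M)"
        by (rule Bochner_Integration.integral_nonneg_AE) (auto intro: X_nonneg)
      with X_le[of 1] show ?thesis by simp
    qed
    ultimately show False using \<theta> by (simp add: ennreal_le_iff)
  qed
  with that show ?thesis by blast
qed

end

section \<open>Good times\<close>

text \<open>Walk back from \<open>P\<close>. At the end of a drop, jump to its start: at most
  \<open>q\<close> counted indices are passed, paid for by the fall of at least
  \<open>\<epsilon> * q\<close>. Elsewhere step back by one, at the cost of one term of
  \<open>e\<close>.\<close>

lemma card_drops_le:
  fixes a e :: "nat \<Rightarrow> real" and \<epsilon> :: real
  assumes step: "\<And>p. p < P \<Longrightarrow> a (Suc p) \<le> a p + e (Suc p)"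
    and e: "\<And>p. 0 \<le> e p" and \<epsilon>: "0 \<le> \<epsilon>"
  shows "\<epsilon> * card {p \<in> {1..P}. \<exists>q\<in>{1..p}. a p - a (p - q) \<le> - \<epsilon> * q} \<le> a 0 - a P + (\<Sum>p=1..P. e p)"
  using step
proof (induction P rule: less_induct)
  case (less P)
  define D where "D P = {p \<in> {1..P}. \<exists>q\<in>{1..p}. a p - a (p - q) \<le> - \<epsilon> * q}" for P
  have fin: "finite (D P)" for P by (simp add: D_def)
  have IH: "\<epsilon> * card (D p) \<le> a 0 - a p + (\<Sum>p=1..p. e p)" if "p < P" for p
    unfolding D_def using that less.prems by (intro less.IH) auto
  have "\<epsilon> * card (D P) \<le> a 0 - a P + (\<Sum>p=1..P. e p)"
  proof (cases "P \<in> D P")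
    case True
    then obtain q where q: "q \<in> {1..P}" "a P - a (P - q) \<le> - \<epsilon> * q" by (auto simp: D_def)
    have "D P \<subseteq> D (P - q) \<union> {P - q<..P}" by (auto simp: D_def)
    then have "card (D P) \<le> card (D (P - q) \<union> {P - q<..P})"
      by (intro card_mono) (auto simp: fin)
    also have "\<dots> \<le> card (D (P - q)) + card {P - q<..P}" by (rule card_Un_le)
    also have "card {P - q<..P} = q" using q by simp
    finally have "\<epsilon> * card (D P) \<le> \<epsilon> * card (D (P - q)) + \<epsilon> * q"
      using \<epsilon> by (simp add: distrib_left[symmetric] mult_left_mono flip: of_nat_add)
    also have "\<epsilon> * card (D (P - q)) \<le> a 0 - a (P - q) + (\<Sum>p=1..P - q. e p)"
      using q by (intro IH) auto
    also have "(\<Sum>p=1..P - q. e p) \<le> (\<Sum>p=1..P. e p)"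
      by (intro sum_mono2) (auto simp: e)
    finally show ?thesis using q by simp
  next
    case False
    show ?thesis
    proof (cases P)
      case 0
      then show ?thesis by (simp add: D_def)
    next
      case (Suc p)
      have "D P \<subseteq> D p"
      proof
        fix x assume x: "x \<in> D P"
        with False have "x \<noteq> P" by blast
        with x Suc show "x \<in> D p" by (auto simp: D_def)
      qed
      then have "\<epsilon> * card (D P) \<le> \<epsilon> * card (D p)"
        using \<epsilon> by (intro mult_left_mono) (auto intro: card_mono fin)
      also have "\<dots> \<le> a 0 - a p + (\<Sum>p=1..p. e p)"
        using Suc by (intro IH) auto
      finally show ?thesis
        using less.prems[of p] Suc by simp
    qed
  qed
  then show ?case by (simp add: D_def)
qed

section \<open>Density of bad times and existence of good ones\<close>

context subadditive_cocycle
begin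

text \<open>Recentred by \<open>rate\<close>, the condition says that prepending
  \<open>q * s\<close> steps to a segment of length \<open>n - q * s\<close> lowers the cocycle at
  speed at least \<open>\<epsilon>\<close>. The bound \<open>q \<ge> 1\<close> excludes the trivial
  stretch and \<open>K\<close> the short ones.\<close>

definition drop_set :: "real \<Rightarrow> nat \<Rightarrow> nat \<Rightarrow> nat \<Rightarrow> 'w set" where
  "drop_set \<epsilon> s K n = {w \<in> space M. \<exists>q\<ge>1. q * s \<le> n \<and> K \<le> q * s \<and>
     v n w - v (n - q * s) ((T ^^ (q * s)) w) \<le> (rate - \<epsilon>) * real (q * s)}"

lemma drop_set_measurable [measurable]: "drop_set \<epsilon> s K n \<in> sets M"
proof -
  have "v m \<circ> (T ^^ l) \<in> borel_measurable M" for m l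
    by (rule measurable_comp[OF measurable_T_pow v_measurable])
  then have [measurable]: "(\<lambda>w. v m ((T ^^ l) w)) \<in> borel_measurable M" for m l
    by (simp add: comp_def)
  show ?thesis unfolding drop_set_def by measurable
qed

lemma drop_set_mono: "K \<le> K' \<Longrightarrow> drop_set \<epsilon> s K' n \<subseteq> drop_set \<epsilon> s K n"
  unfolding drop_set_def by auto

lemma drop_set_empty: "n < K \<Longrightarrow> drop_set \<epsilon> s K n = {}"
  unfolding drop_set_def by auto

lemma drop_set_empty_modulus: "n < s \<Longrightarrow> drop_set \<epsilon> s K n = {}"
proof -
  assume "n < s"
  moreover have "s \<le> q * s" if "1 \<le> q" for q using that by (cases q) auto
  ultimately have "\<not> q * s \<le> n" if "1 \<le> q" for q using that by (meson le_trans not_le)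
  then show "drop_set \<epsilon> s K n = {}"
    by (auto simp: drop_set_def)
qed

text \<open>For fixed \<open>N\<close> the functions \<open>v n \<circ> T ^^ (N - n)\<close>, \<open>n \<le> N\<close>, play the role of the cocycle along a
  backward orbit, which makes an invertible extension of \<open>T\<close> unnecessary. They are sampled along the
  residue class of \<open>i\<close> modulo \<open>s\<close>.\<close>
lemma sum_prob_drop_set_class:
  assumes s: "1 \<le> s" and i: "i < s" and \<epsilon>: "0 < \<epsilon>"
  shows "\<epsilon> * s * (\<Sum>p=1..P. prob (drop_set \<epsilon> s 0 (i + p * s)))
    \<le> (\<integral>w. v i w \<partial>M) + P * (\<integral>w. excess s w \<partial>M)"
proof -
  define N where "N = i + P * s"
  \<comment> \<open>From \<open>S p w\<close>, \<open>i + p * s\<close> steps remain before the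
    fixed end time \<open>N\<close>; raising \<open>p\<close> by one prepends \<open>s\<close>
    steps.\<close>
  define S where "S p = T ^^ (N - (i + p * s))" for p
  define a where "a p w = v (i + p * s) (S p w) - rate * (i + p * s)" for p w
  define e where "e p w = excess s (S p w)" for p w
  define B where "B p = drop_set \<epsilon> s 0 (i + p * s)" for p
  have S_space: "S p w \<in> space M" if "w \<in> space M" for p w
    using that by (simp add: S_def T_pow_space)
  have S_shift: "(T ^^ (q * s)) (S p w) = S (p - q) w" if "q \<le> p" "p \<le> P" for p q w
  proof -
    obtain d where d: "p = q + d" using \<open>q \<le> p\<close> le_Suc_ex by blast
    obtain r where r: "P = p + r" using \<open>p \<le> P\<close> le_Suc_ex by blast
    have "q * s + (N - (i + p * s)) = N - (i + (p - q) * s)"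
      by (simp add: d r N_def add_mult_distrib)
    moreover have "(T ^^ m) ((T ^^ n) w) = (T ^^ (m + n)) w" for m n
      by (simp add: funpow_add)
    ultimately show ?thesis by (simp add: S_def)
  qed
  have count: "\<epsilon> * s * (\<Sum>p=1..P. indicator (B p) (S p w)) \<le> a 0 w - a P w + (\<Sum>p=1..P. e p w)"
    if w: "w \<in> space M" for w
  proof -
    let ?D = "{p \<in> {1..P}. \<exists>q\<in>{1..p}. a p w - a (p - q) w \<le> - (\<epsilon> * s) * q}"
    have "p \<in> ?D" if p: "p \<in> {1..P}" and B: "S p w \<in> B p" for p
    proof -
      obtain q where q: "1 \<le> q" "q * s \<le> i + p * s"
        and le: "v (i + p * s) (S p w) - v (i + p * s - q * s) ((T ^^ (q * s)) (S p w))
          \<le> (rate - \<epsilon>) * real (q * s)"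
        using B by (auto simp: B_def drop_set_def)
      \<comment> \<open>Because \<open>i < s\<close>, a stretch of \<open>q\<close> blocks inside
        \<open>i + p * s\<close> steps has \<open>q \<le> p\<close>, so index \<open>p - q\<close>
        lies in the same residue class.\<close>
      have "q * s < Suc p * s" using q i by simp
      then have qp: "q \<le> p" by (simp only: mult_less_cancel2 less_Suc_eq_le)
      then obtain d where d: "p = q + d" using le_Suc_ex by blast
      then have "i + p * s - q * s = i + d * s"
        by (simp add: add_mult_distrib)
      with le have "v (i + p * s) (S p w) - v (i + d * s) (S d w) \<le> (rate - \<epsilon>) * real (q * s)"
        using S_shift[OF qp, of w] p d by simp
      then have "a p w - a (p - q) w \<le> - (\<epsilon> * s) * q"
        by (simp add: a_def d algebra_simps)
      with p q qp show ?thesis by auto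
    qed
    then have "(\<Sum>p=1..P. indicator (B p) (S p w)) \<le> (\<Sum>p=1..P. indicator ?D p :: real)"
      by (intro sum_mono) (auto simp: indicator_def)
    also have "\<dots> = card ?D"
      by (simp add: indicator_def sum.If_cases Int_def)
    finally have "\<epsilon> * s * (\<Sum>p=1..P. indicator (B p) (S p w)) \<le> \<epsilon> * s * card ?D"
      using \<epsilon> by (intro mult_left_mono) auto
    also have "\<dots> \<le> a 0 w - a P w + (\<Sum>p=1..P. e p w)"
    proof (rule card_drops_le)
      fix p assume p: "p < P"
      have "v (s + (i + p * s)) (S (Suc p) w) \<le> v s (S (Suc p) w) + v (i + p * s) ((T ^^ s) (S (Suc p) w))"
        by (rule v_subadd[OF S_space[OF w]])
      also have "(T ^^ s) (S (Suc p) w) = S p w"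
        using S_shift[of 1 "Suc p" w] p by simp
      finally show "a (Suc p) w \<le> a p w + e (Suc p) w"
        by (simp add: a_def e_def excess_def algebra_simps)
    qed (use \<epsilon> in \<open>auto simp: e_def excess_nonneg\<close>)
    finally show ?thesis .
  qed
  have ind_int: "integrable M (\<lambda>w. indicator (B p) (S p w) :: real)" for p
    unfolding S_def B_def
    by (rule integrable_T_pow) (simp add: integrable_indicator_iff emeasure_eq_measure)
  \<comment> \<open>The indicators are evaluated at different points \<open>S p w\<close>;
    invariance of the measure makes each mean a probability of \<open>B p\<close>.\<close>
  have ind: "(\<integral>w. indicator (B p) (S p w) \<partial>M) = prob (B p)" for p
    unfolding S_def B_def by (subst integral_T_pow) (auto simp: Int_absorb2 sets.sets_into_space)
  have v_int: "integrable M (\<lambda>w. v n (S p w))" for n p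
    unfolding S_def by (rule integrable_T_pow[OF v_integrable])
  have a_int: "integrable M (a p)" for p
    unfolding a_def[abs_def] using v_int by simp
  have a: "(\<integral>w. a p w \<partial>M) = (\<integral>w. v (i + p * s) w \<partial>M) - rate * (i + p * s)" for p
    unfolding a_def using v_int
    by (simp add: prob_space) (simp add: S_def integral_T_pow)
  have e_int: "integrable M (e p)" for p
    unfolding e_def[abs_def] S_def by (rule integrable_T_pow[OF excess_integrable])
  have e: "(\<integral>w. e p w \<partial>M) = (\<integral>w. excess s w \<partial>M)" for p
    unfolding e_def S_def by (rule integral_T_pow) simp
  have "\<epsilon> * s * (\<Sum>p=1..P. prob (B p)) = (\<integral>w. \<epsilon> * s * (\<Sum>p=1..P. indicator (B p) (S p w)) \<partial>M)"
    by (simp add: ind ind_int)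
  also have "\<dots> \<le> (\<integral>w. a 0 w - a P w + (\<Sum>p=1..P. e p w) \<partial>M)"
    by (intro integral_mono count Bochner_Integration.integrable_add
        Bochner_Integration.integrable_diff Bochner_Integration.integrable_sum
        integrable_mult_right a_int e_int ind_int)
  also have "\<dots> = (\<integral>w. a 0 w \<partial>M) - (\<integral>w. a P w \<partial>M) + P * (\<integral>w. excess s w \<partial>M)"
    by (simp add: a_int e_int e)
  \<comment> \<open>\<open>rate_le\<close> makes the mean of \<open>a P\<close> nonnegative, and
    \<open>rate_nonneg\<close> lets the recentring of \<open>a 0\<close> be dropped.\<close>
  also have "\<dots> \<le> (\<integral>w. v i w \<partial>M) + P * (\<integral>w. excess s w \<partial>M)"
    using rate_le[of "i + P * s"] mult_nonneg_nonneg[OF rate_nonneg of_nat_0_le_iff[of i]] by (simp add: a)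
  finally show ?thesis by (simp add: B_def)
qed

text \<open>Each \<open>n \<ge> s\<close> is \<open>n mod s + (n div s) * s\<close> with positive
  quotient, and for \<open>n < s\<close> the drop set is empty, so the estimates for the residue
  classes add up.\<close>

lemma sum_prob_drop_set:
  assumes s: "1 \<le> s" and \<epsilon>: "0 < \<epsilon>"
  shows "\<epsilon> * s * (\<Sum>n<N. prob (drop_set \<epsilon> s 0 n))
    \<le> s * (\<Sum>i<s. \<integral>w. v i w \<partial>M) + N * (\<integral>w. excess s w \<partial>M)"
proof -
  let ?p = "\<lambda>n. prob (drop_set \<epsilon> s 0 n)" and ?I = "{..<s} \<times> {1..N div s}"
    and ?E = "\<integral>w. excess s w \<partial>M"
  have E: "0 \<le> ?E" by (simp add: excess_nonneg)
  have "(\<Sum>n<N. ?p n) = (\<Sum>n\<in>{s..<N}. ?p n)"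
    by (rule sum.mono_neutral_right) (auto simp: drop_set_empty_modulus)
  also have "\<dots> \<le> (\<Sum>(i, p)\<in>?I. ?p (i + p * s))"
  proof (rule sum_le_included[where i = "\<lambda>(i, p). i + p * s"])
    show "\<forall>n\<in>{s..<N}. \<exists>y\<in>?I. (case y of (i, p) \<Rightarrow> i + p * s) = n
        \<and> ?p n \<le> (case y of (i, p) \<Rightarrow> ?p (i + p * s))"
    proof
      fix n assume n: "n \<in> {s..<N}"
      show "\<exists>y\<in>?I. (case y of (i, p) \<Rightarrow> i + p * s) = n \<and> ?p n \<le> (case y of (i, p) \<Rightarrow> ?p (i + p * s))"
        using n s by (intro bexI[of _ "(n mod s, n div s)"])
          (auto simp: div_le_mono div_greater_zero_iff Suc_le_eq)
    qed
  qed auto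
  also have "\<dots> = (\<Sum>i<s. \<Sum>p=1..N div s. ?p (i + p * s))"
    by (rule sum.cartesian_product[symmetric])
  finally have "\<epsilon> * s * (\<Sum>n<N. ?p n) \<le> \<epsilon> * s * (\<Sum>i<s. \<Sum>p=1..N div s. ?p (i + p * s))"
    using \<epsilon> by (intro mult_left_mono) auto
  also have "\<dots> = (\<Sum>i<s. \<epsilon> * s * (\<Sum>p=1..N div s. ?p (i + p * s)))"
    by (rule sum_distrib_left)
  also have "\<dots> \<le> (\<Sum>i<s. (\<integral>w. v i w \<partial>M) + (N div s) * ?E)"
    using s \<epsilon> by (intro sum_mono sum_prob_drop_set_class) auto
  also have "\<dots> = (\<Sum>i<s. \<integral>w. v i w \<partial>M) + real (s * (N div s)) * ?E"
    by (simp add: sum.distrib)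
  also have "\<dots> \<le> s * (\<Sum>i<s. \<integral>w. v i w \<partial>M) + N * ?E"
  proof (intro add_mono mult_right_mono E)
    have "0 \<le> (\<Sum>i<s. \<integral>w. v i w \<partial>M)"
      by (intro sum_nonneg Bochner_Integration.integral_nonneg_AE) (auto intro: v_nonneg)
    then show "(\<Sum>i<s. \<integral>w. v i w \<partial>M) \<le> s * (\<Sum>i<s. \<integral>w. v i w \<partial>M)"
      using s by (simp add: mult_le_cancel_right1)
  qed (simp flip: of_nat_mult)
  finally show ?thesis .
qed

text \<open>The choice of \<open>s\<close> makes the excess cost half of \<open>\<delta>\<close>.
  The constant term costs at most the other half once \<open>N > K\<close>, and for
  \<open>N \<le> K\<close> all the sets involved are empty. The free bound \<open>k\<close> later
  keeps a union over precisions finite.\<close>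

lemma drop_set_density:
  fixes \<epsilon> \<delta> :: real
  assumes \<epsilon>: "0 < \<epsilon>" and \<delta>: "0 < \<delta>"
  obtains s K where "1 \<le> s" "k \<le> K" "\<And>N. (\<Sum>n<N. prob (drop_set \<epsilon> s K n)) \<le> \<delta> * N"
proof -
  obtain s where s: "1 \<le> s" and ex: "(\<integral>w. excess s w \<partial>M) \<le> \<epsilon> * \<delta> / 2 * s"
    using excess_small[of "\<epsilon> * \<delta> / 2"] \<epsilon> \<delta> by auto
  define C where "C = (\<Sum>i<s. \<integral>w. v i w \<partial>M)"
  obtain K0 :: nat where K0: "2 * C / (\<epsilon> * \<delta>) \<le> K0" using real_arch_simple by blast
  define K where "K = max k K0"
  have "(\<Sum>n<N. prob (drop_set \<epsilon> s K n)) \<le> \<delta> * N" for N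
  proof (cases "N \<le> K")
    case True
    then have "(\<Sum>n<N. prob (drop_set \<epsilon> s K n)) = 0"
      by (intro sum.neutral) (auto simp: drop_set_empty)
    then show ?thesis using \<delta> by simp
  next
    case False
    have "\<epsilon> * s * (\<Sum>n<N. prob (drop_set \<epsilon> s 0 n)) \<le> s * C + N * (\<integral>w. excess s w \<partial>M)"
      unfolding C_def by (rule sum_prob_drop_set[OF s \<epsilon>])
    also have "\<dots> \<le> s * (\<epsilon> * \<delta> / 2 * N) + N * (\<epsilon> * \<delta> / 2 * s)"
    proof (intro add_mono mult_left_mono ex)
      have "2 * C / (\<epsilon> * \<delta>) \<le> N" using K0 False by (simp add: K_def)
      then show "C \<le> \<epsilon> * \<delta> / 2 * N" using \<epsilon> \<delta> by (simp add: field_simps)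
    qed auto
    also have "\<dots> = \<epsilon> * s * (\<delta> * N)" by (simp add: field_simps)
    finally have "(\<Sum>n<N. prob (drop_set \<epsilon> s 0 n)) \<le> \<delta> * N"
      using \<epsilon> s by (subst (asm) mult_le_cancel_left_pos) auto
    moreover have "(\<Sum>n<N. prob (drop_set \<epsilon> s K n)) \<le> (\<Sum>n<N. prob (drop_set \<epsilon> s 0 n))"
      by (intro sum_mono finite_measure_mono drop_set_mono) auto
    ultimately show ?thesis by simp
  qed
  with s show ?thesis by (intro that[of s K]) (auto simp: K_def)
qed

text \<open>\<open>j\<close> indexes the precision. The same infinitely many \<open>n\<close> serve
  every \<open>j\<close>, while \<open>s j\<close> and \<open>K j\<close> are fixed before
  \<open>n\<close>; the passage to a limit functional rests on this order.\<close>

definition has_good_times :: "'w \<Rightarrow> bool" where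
  "has_good_times w \<longleftrightarrow> (\<exists>s K :: nat \<Rightarrow> nat. (\<forall>j. 1 \<le> s j) \<and>
     (\<exists>\<^sub>\<infinity>n. \<forall>j q. 1 \<le> q \<longrightarrow> q * s j \<le> n \<longrightarrow> K j \<le> q * s j \<longrightarrow>
        (rate - inverse (Suc j)) * real (q * s j) < v n w - v (n - q * s j) ((T ^^ (q * s j)) w)))"

text \<open>The bad sets have average probability at most \<open>\<eta>\<close>, so infinitely many
  have probability at most \<open>2 * \<eta>\<close>. Continuity from above then bounds the
  probability of avoiding bad sets infinitely often.\<close>

lemma has_good_times_prob:
  fixes \<eta> :: real
  assumes \<eta>: "0 < \<eta>"
  obtains L where "L \<in> sets M" "1 - 2 * \<eta> \<le> prob L" "\<And>w. w \<in> L \<Longrightarrow> has_good_times w"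
proof -
  define \<epsilon> where "\<epsilon> j = inverse (real (Suc j))" for j
  \<comment> \<open>Geometric weights keep the total density over all precisions at most
    \<open>\<eta>\<close>.\<close>
  define \<delta> where "\<delta> j = \<eta> * (1 / 2) ^ Suc j" for j
  have "\<exists>s K. 1 \<le> s \<and> Suc j \<le> K \<and> (\<forall>N. (\<Sum>n<N. prob (drop_set (\<epsilon> j) s K n)) \<le> \<delta> j * N)" for j
    using drop_set_density[of "\<epsilon> j" "\<delta> j" "Suc j"] \<eta> unfolding \<epsilon>_def \<delta>_def
    by (smt (verit) half_gt_zero inverse_positive_iff_positive mult_pos_pos of_nat_0_less_iff
        zero_less_Suc zero_less_power)
  then obtain s K where s: "\<And>j. 1 \<le> s j" and K: "\<And>j. Suc j \<le> K j"
    and dens: "\<And>j N. (\<Sum>n<N. prob (drop_set (\<epsilon> j) (s j) (K j) n)) \<le> \<delta> j * N"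
    by metis
  define B where "B n = (\<Union>j. drop_set (\<epsilon> j) (s j) (K j) n)" for n
  have [measurable]: "B n \<in> sets M" for n by (simp add: B_def)
  \<comment> \<open>A drop needs \<open>K j \<le> n\<close> while \<open>j < K j\<close>, so only
    \<open>j < n\<close> contribute and finite subadditivity applies.\<close>
  have B_fin: "B n = (\<Union>j<n. drop_set (\<epsilon> j) (s j) (K j) n)" for n
  proof -
    have "j < n" if "x \<in> drop_set (\<epsilon> j) (s j) (K j) n" for x j
      using K[of j] that drop_set_empty[of n "K j"] by (cases "n < K j") auto
    then show ?thesis by (auto simp: B_def)
  qed
  have \<delta>_sum: "(\<Sum>j<N. \<delta> j) \<le> \<eta>" for N
  proof -
    have "(\<Sum>j<N. \<delta> j) = \<eta> * (1 - (1 / 2) ^ N)"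
      by (induction N) (simp_all add: \<delta>_def field_simps)
    also have "\<dots> \<le> \<eta> * 1" using \<eta> by (intro mult_left_mono) auto
    finally show ?thesis by simp
  qed
  have sum_B: "(\<Sum>n<N. prob (B n)) \<le> \<eta> * N" for N
  proof -
    have "(\<Sum>n<N. prob (B n)) \<le> (\<Sum>n<N. \<Sum>j<N. prob (drop_set (\<epsilon> j) (s j) (K j) n))"
    proof (intro sum_mono)
      fix n assume n: "n \<in> {..<N}"
      have "prob (B n) \<le> (\<Sum>j<n. prob (drop_set (\<epsilon> j) (s j) (K j) n))"
        unfolding B_fin by (intro measure_UNION_le) auto
      also have "\<dots> \<le> (\<Sum>j<N. prob (drop_set (\<epsilon> j) (s j) (K j) n))"
        using n by (intro sum_mono2) auto
      finally show "prob (B n) \<le> (\<Sum>j<N. prob (drop_set (\<epsilon> j) (s j) (K j) n))" .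
    qed
    also have "\<dots> = (\<Sum>j<N. \<Sum>n<N. prob (drop_set (\<epsilon> j) (s j) (K j) n))" by (rule sum.swap)
    also have "\<dots> \<le> (\<Sum>j<N. \<delta> j * N)" by (intro sum_mono dens)
    also have "\<dots> = (\<Sum>j<N. \<delta> j) * N" by (simp add: sum_distrib_right)
    also have "\<dots> \<le> \<eta> * N" by (intro mult_right_mono \<delta>_sum) simp
    finally show ?thesis .
  qed
  have inf: "\<exists>n\<ge>m. prob (B n) \<le> 2 * \<eta>" for m
  proof (rule ccontr)
    assume "\<not> ?thesis"
    then have big: "2 * \<eta> \<le> prob (B n)" if "m \<le> n" for n using that by force
    \<comment> \<open>The \<open>m + 1\<close> indices from \<open>m\<close> to \<open>2 * m\<close>
      would contribute at least \<open>\<eta> * (2 * m + 2)\<close>, more than the allowed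
      \<open>\<eta> * (2 * m + 1)\<close>.\<close>
    define N where "N = 2 * m + 1"
    have "2 * \<eta> * real (m + 1) = (\<Sum>n\<in>{m..<N}. 2 * \<eta>)" by (simp add: N_def)
    also have "\<dots> \<le> (\<Sum>n\<in>{m..<N}. prob (B n))" by (intro sum_mono big) simp
    also have "\<dots> \<le> (\<Sum>n<N. prob (B n))" by (intro sum_mono2) auto
    also have "\<dots> \<le> \<eta> * N" by (rule sum_B)
    finally show False using \<eta> by (simp add: N_def field_simps)
  qed
  define A where "A m = (\<Union>n\<in>{m..}. space M - B n)" for m :: nat
  have A_sets: "A m \<in> sets M" for m unfolding A_def by measurable
  have "1 - 2 * \<eta> \<le> prob (A m)" for m
  proof -
    obtain n where n: "m \<le> n" "prob (B n) \<le> 2 * \<eta>" using inf by blast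
    have "1 - 2 * \<eta> \<le> prob (space M - B n)" using n by (simp add: prob_compl)
    also have "\<dots> \<le> prob (A m)"
      using n A_sets by (intro finite_measure_mono) (auto simp: A_def)
    finally show ?thesis .
  qed
  moreover have "(\<lambda>m. prob (A m)) \<longlonglongrightarrow> prob (\<Inter>m. A m)"
    using A_sets by (intro finite_Lim_measure_decseq) (auto simp: decseq_def A_def)
  ultimately have "1 - 2 * \<eta> \<le> prob (\<Inter>m. A m)"
    by (intro LIMSEQ_le_const) auto
  moreover have "(\<Inter>m. A m) \<in> sets M" using A_sets by auto
  moreover have "has_good_times w" if w: "w \<in> (\<Inter>m. A m)" for w
  proof -
    have "\<exists>n\<ge>m. w \<in> space M - B n" for m using w by (auto simp: A_def)
    then have "\<exists>\<^sub>\<infinity>n. w \<in> space M - B n" unfolding INFM_nat_le by blast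
    then have "\<exists>\<^sub>\<infinity>n. \<forall>j q. 1 \<le> q \<longrightarrow> q * s j \<le> n \<longrightarrow> K j \<le> q * s j \<longrightarrow>
        (rate - inverse (Suc j)) * real (q * s j) < v n w - v (n - q * s j) ((T ^^ (q * s j)) w)"
    proof (rule INFM_mono, intro allI impI)
      fix n j q
      assume "w \<in> space M - B n" and q: "1 \<le> q" "q * s j \<le> n" "K j \<le> q * s j"
      then have "w \<in> space M" "w \<notin> drop_set (\<epsilon> j) (s j) (K j) n" by (auto simp: B_def)
      with q show "(rate - inverse (Suc j)) * real (q * s j) < v n w - v (n - q * s j) ((T ^^ (q * s j)) w)"
        unfolding drop_set_def \<epsilon>_def not_le[symmetric] by blast
    qed
    with s show ?thesis unfolding has_good_times_def by blast
  qed
  ultimately show ?thesis by (intro that[of "\<Inter>m. A m"]) blast+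
qed

text \<open>Taking \<open>\<eta>\<close> to 0, the union of the measurable sets from
  \<open>has_good_times_prob\<close> has full measure.\<close>

lemma AE_has_good_times: "AE w in M. has_good_times w"
proof -
  have "\<exists>L. L \<in> sets M \<and> 1 - 2 * inverse (Suc i) \<le> prob L \<and> (\<forall>w\<in>L. has_good_times w)" for i :: nat
    using has_good_times_prob[of "inverse (Suc i)"] by (metis inverse_positive_iff_positive of_nat_0_less_iff zero_less_Suc)
  then obtain L where L: "\<And>i. L i \<in> sets M" "\<And>i. 1 - 2 * inverse (Suc i) \<le> prob (L i)"
    "\<And>i w. w \<in> L i \<Longrightarrow> has_good_times w"
    by metis
  have "(\<lambda>i. 1 - 2 * inverse (real (Suc i))) \<longlonglongrightarrow> 1 - 2 * 0"
    by (intro tendsto_intros LIMSEQ_inverse_real_of_nat)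
  moreover have "1 - 2 * inverse (Suc i) \<le> prob (\<Union>i. L i)" for i
    using L(2)[of i] by (rule order_trans) (intro finite_measure_mono, use L(1) in auto)
  ultimately have "1 \<le> prob (\<Union>i. L i)"
    by (intro LIMSEQ_le_const2) auto
  then have "prob (\<Union>i. L i) = 1" using prob_le_1 by (intro antisym) auto
  then have "AE w in M. w \<in> (\<Union>i. L i)" using L(1) by (subst (asm) prob_eq_1) auto
  then show ?thesis by eventually_elim (use L(3) in auto)
qed

end

section \<open>Metric functionals\<close>

text \<open>Tychonoff's theorem for a product of compact intervals.\<close>

lemma compact_pointwise_box:
  fixes l u :: "'z \<Rightarrow> real"
  shows "compact {h. \<forall>x. h x \<in> {l x..u x}}"
proof -
  have "compactin (product_topology (\<lambda>_. euclidean) UNIV) (Pi\<^sub>E UNIV (\<lambda>x. {l x..u x}))"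
    by (subst compactin_PiE) auto
  then have "compact (Pi\<^sub>E UNIV (\<lambda>x. {l x..u x}))"
    by (simp add: euclidean_product_topology)
  also have "Pi\<^sub>E UNIV (\<lambda>x. {l x..u x}) = {h. \<forall>x. h x \<in> {l x..u x}}"
    by (auto simp: PiE_UNIV_domain)
  finally show ?thesis .
qed

text \<open>Any finitely many of these closures share a value \<open>S n\<close>, so compactness
  applies. Closures of tails replace a convergent subsequence, which may fail to exist in an
  uncountable product.\<close>

lemma frequently_cluster_point:
  fixes S :: "nat \<Rightarrow> 'a::topological_space"
  assumes K: "compact K" "\<And>n. S n \<in> K" and P: "\<exists>\<^sub>\<infinity>n. P n"
  shows "\<exists>x. \<forall>m. x \<in> closure (S ` {n. m \<le> n \<and> P n})"
proof -
  have "K \<inter> (\<Inter>m. closure (S ` {n. m \<le> n \<and> P n})) \<noteq> {}"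
  proof (rule compact_imp_fip_image[OF K(1)])
    fix I :: "nat set" assume "finite I"
    then obtain b where b: "\<And>m. m \<in> I \<Longrightarrow> m \<le> b" by (meson finite_nat_set_iff_bounded_le)
    obtain n where n: "b \<le> n" "P n" using P by (auto simp: INFM_nat_le)
    have "S n \<in> closure (S ` {n. m \<le> n \<and> P n})" if "m \<in> I" for m
      using n b[OF that] by (intro subsetD[OF closure_subset]) auto
    then show "K \<inter> (\<Inter>m\<in>I. closure (S ` {n. m \<le> n \<and> P n})) \<noteq> {}"
      using K(2)[of n] by auto
  qed simp
  then show ?thesis by blast
qed

section \<open>Basic properties of metric functionals\<close>

lemma pseudo_metricD:
  assumes "pseudo_metric d"
  shows "0 \<le> d x y" "d x x = 0" "d x y = d y x" "d x z \<le> d x y + d y z"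
  using assms by (auto simp: pseudo_metric_def)

lemma closed_functional_le:
  fixes c :: real
  shows "closed {h. h x \<le> c}"
  by (intro closed_Collect_le continuous_on_const continuous_on_product_coordinates)

lemma metric_functional_base:
  assumes "h \<in> metric_functionals d z0"
  shows "h z0 = 0"
proof -
  have "metric_functionals d z0 \<subseteq> {h. h z0 = 0}"
    unfolding metric_functionals_def
    by (intro closure_minimal closed_Collect_eq continuous_on_const continuous_on_product_coordinates) auto
  with assms show ?thesis by auto
qed

lemma metric_functional_lipschitz:
  assumes d: "pseudo_metric d" and h: "h \<in> metric_functionals d z0"
  shows "h x - h y \<le> d x y"
proof -
  have "metric_functionals d z0 \<subseteq> {h. h x - h y \<le> d x y}"
    unfolding metric_functionals_def
  proof (intro closure_minimal closed_Collect_le continuous_on_const continuous_on_diff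
      continuous_on_product_coordinates)
    show "range (\<lambda>z x. d x z - d z0 z) \<subseteq> {h. h x - h y \<le> d x y}"
      using pseudo_metricD(4)[OF d, of x _ y] by (auto simp: algebra_simps)
  qed
  with h show ?thesis by auto
qed

lemma borel_measurable_pm_borel_dist:
  assumes d: "pseudo_metric d"
  shows "(\<lambda>x. d x z) \<in> borel_measurable (pm_borel d)"
  unfolding borel_measurable_iff_greater
proof
  fix a
  have "pm_open d {x. a < d x z}"
    unfolding pm_open_def
  proof
    fix x assume x: "x \<in> {x. a < d x z}"
    have "{y. d x y < d x z - a} \<subseteq> {x. a < d x z}"
    proof clarify
      fix y assume "d x y < d x z - a"
      then show "a < d y z" using pseudo_metricD(4)[OF d, of x z y] by linarith
    qed
    with x show "\<exists>e>0. {y. d x y < e} \<subseteq> {x. a < d x z}"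
      by (intro exI[of _ "d x z - a"]) auto
  qed
  then show "{x \<in> space (pm_borel d). a < d x z} \<in> sets (pm_borel d)"
    by (simp add: pm_borel_def space_measure_of_conv)
qed

lemma tendsto_over_n_bounded_diff:
  fixes f g :: "nat \<Rightarrow> real"
  assumes f: "(\<lambda>n. f n / n) \<longlonglongrightarrow> \<tau>" and C: "\<And>n. \<bar>g n - f n\<bar> \<le> C"
  shows "(\<lambda>n. g n / n) \<longlonglongrightarrow> \<tau>"
proof -
  have "(\<lambda>n. (g n - f n) / n) \<longlonglongrightarrow> 0"
  proof (rule Lim_null_comparison)
    show "\<forall>\<^sub>F n in sequentially. norm ((g n - f n) / n) \<le> C / n"
      using C by (intro always_eventually allI) (simp add: divide_right_mono)
  qed (rule lim_const_over_n)
  from tendsto_add[OF this f] show ?thesis by (simp add: diff_divide_distrib)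
qed

section \<open>Cocycles of nonexpansive maps\<close>

lemma cocycle_add: "cocycle T \<phi> (m + n) w = cocycle T \<phi> m w \<circ> cocycle T \<phi> n ((T ^^ m) w)"
proof (induction n)
  case (Suc n)
  have "(T ^^ n) ((T ^^ m) w) = (T ^^ (m + n)) w" by (subst add.commute) (simp add: funpow_add)
  with Suc show ?case by (simp add: comp_assoc)
qed simp

locale nonexpansive_cocycle = ergodic_system M T for M :: "'w measure" and T +
  fixes d :: "'z \<Rightarrow> 'z \<Rightarrow> real" and \<phi> :: "'w \<Rightarrow> 'z \<Rightarrow> 'z" and z0 :: 'z
  assumes d: "pseudo_metric d"
    and nonexp: "\<And>w x y. w \<in> space M \<Longrightarrow> d (\<phi> w x) (\<phi> w y) \<le> d x y"
    and measurable_cocycle: "\<And>z n. (\<lambda>w. cocycle T \<phi> n w z) \<in> M \<rightarrow>\<^sub>M pm_borel d"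
    and integr: "\<exists>z. (\<integral>\<^sup>+ w. ennreal (d z (\<phi> w z)) \<partial>M) < \<infinity>"
begin

abbreviation u :: "nat \<Rightarrow> 'w \<Rightarrow> 'z \<Rightarrow> 'z" where
  "u \<equiv> cocycle T \<phi>"

definition drift :: "nat \<Rightarrow> 'w \<Rightarrow> real" where
  "drift n w = d (u n w z0) z0"

lemma u_nonexp: "w \<in> space M \<Longrightarrow> d (u n w x) (u n w y) \<le> d x y"
proof (induction n arbitrary: x y)
  case (Suc n)
  have "d (u n w (\<phi> ((T ^^ n) w) x)) (u n w (\<phi> ((T ^^ n) w) y)) \<le> d (\<phi> ((T ^^ n) w) x) (\<phi> ((T ^^ n) w) y)"
    using Suc by blast
  also have "\<dots> \<le> d x y" by (intro nonexp T_pow_space Suc.prems)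
  finally show ?case by simp
qed simp

lemma measurable_dist_cocycle [measurable]: "(\<lambda>w. d (u n w z) y) \<in> borel_measurable M"
  by (rule measurable_compose[OF measurable_cocycle borel_measurable_pm_borel_dist[OF d]])

text \<open>Integrability is given at some \<open>z\<close>; moving the base point to
  \<open>z0\<close> raises the displacement by at most \<open>2 * d z z0\<close>.\<close>

lemma drift_integrable: "integrable M (drift 1)"
proof (rule integrableI_bounded)
  obtain z where z: "(\<integral>\<^sup>+ w. ennreal (d z (\<phi> w z)) \<partial>M) < \<infinity>" using integr by blast
  have [measurable]: "(\<lambda>w. d z (\<phi> w z)) \<in> borel_measurable M"
    using measurable_dist_cocycle[of 1 z z] by (simp add: pseudo_metricD(3)[OF d, of z])
  have "(\<integral>\<^sup>+ w. ennreal (norm (drift 1 w)) \<partial>M) \<le> (\<integral>\<^sup>+ w. ennreal (d z (\<phi> w z)) + ennreal (2 * d z z0) \<partial>M)"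
  proof (rule nn_integral_mono)
    fix w assume w: "w \<in> space M"
    have "d (\<phi> w z0) z0 \<le> d (\<phi> w z0) (\<phi> w z) + d (\<phi> w z) z + d z z0"
      using pseudo_metricD(4)[OF d, of "\<phi> w z0" z0 "\<phi> w z"] pseudo_metricD(4)[OF d, of "\<phi> w z" z0 z] by simp
    also have "\<dots> \<le> d z (\<phi> w z) + 2 * d z z0"
      using nonexp[OF w, of z0 z] pseudo_metricD(3)[OF d, of z0 z] pseudo_metricD(3)[OF d, of z "\<phi> w z"]
      by linarith
    finally have "norm (drift 1 w) \<le> d z (\<phi> w z) + 2 * d z z0"
      using pseudo_metricD(1)[OF d] by (simp add: drift_def)
    then show "ennreal (norm (drift 1 w)) \<le> ennreal (d z (\<phi> w z)) + ennreal (2 * d z z0)"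
      using pseudo_metricD(1)[OF d] by (simp add: ennreal_leI flip: ennreal_plus del: One_nat_def)
  qed
  also have "\<dots> = (\<integral>\<^sup>+ w. ennreal (d z (\<phi> w z)) \<partial>M) + ennreal (2 * d z z0)"
    by (subst nn_integral_add) (auto simp: emeasure_space_1)
  also have "\<dots> < \<infinity>" using z by (simp add: ennreal_add_less_top)
  finally show "(\<integral>\<^sup>+ w. ennreal (norm (drift 1 w)) \<partial>M) < \<infinity>" .
qed (simp add: drift_def[abs_def] del: One_nat_def)

text \<open>Subadditivity is the triangle inequality through \<open>u m w z0\<close>, followed by
  nonexpansiveness of \<open>u m w\<close>, the left factor in \<open>cocycle_add\<close>.\<close>

sublocale subadditive_cocycle M T drift
proof
  show "drift n \<in> borel_measurable M" for n
    unfolding drift_def[abs_def] by (rule measurable_dist_cocycle)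
  show "drift (m + n) w \<le> drift m w + drift n ((T ^^ m) w)" if w: "w \<in> space M" for m n w
  proof -
    have "drift (m + n) w \<le> d (u m w (u n ((T ^^ m) w) z0)) (u m w z0) + drift m w"
      using pseudo_metricD(4)[OF d] by (simp add: drift_def cocycle_add)
    also have "d (u m w (u n ((T ^^ m) w) z0)) (u m w z0) \<le> drift n ((T ^^ m) w)"
      unfolding drift_def by (rule u_nonexp[OF w])
    finally show ?thesis by simp
  qed
qed (use drift_integrable pseudo_metricD[OF d] in \<open>auto simp: drift_def[abs_def]\<close>)

lemma dist_orbit_le:
  assumes w: "w \<in> space M" and k: "k \<le> n"
  shows "d (u k w z0) (u n w z0) \<le> drift (n - k) ((T ^^ k) w)"
proof -
  have "u n w z0 = u k w (u (n - k) ((T ^^ k) w) z0)"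
    using cocycle_add[of T \<phi> k "n - k" w] k by simp
  then show ?thesis
    using u_nonexp[OF w, of k z0] pseudo_metricD(3)[OF d, of z0] by (simp add: drift_def)
qed

text \<open>The functional based at \<open>u n w z0\<close> is at most
  \<open>drift (n - k) ((T ^^ k) w) - drift n w\<close> at \<open>u k w z0\<close>. For fixed
  \<open>k\<close> the bound this gives holds at all good \<open>n \<ge> k\<close> and is a closed
  condition, so a cluster point inherits it.\<close>

lemma good_times_functional:
  assumes w: "w \<in> space M" and good: "has_good_times w"
  obtains h s K where "h \<in> metric_functionals d z0" "\<And>j. 1 \<le> s j"
    "\<And>j q. 1 \<le> q \<Longrightarrow> K j \<le> q * s j \<Longrightarrow>
      (rate - inverse (Suc j)) * real (q * s j) \<le> - h (u (q * s j) w z0)"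
proof -
  obtain s K where s: "\<And>j. 1 \<le> s j" and inf: "\<exists>\<^sub>\<infinity>n. \<forall>j q. 1 \<le> q \<longrightarrow> q * s j \<le> n \<longrightarrow> K j \<le> q * s j \<longrightarrow>
        (rate - inverse (Suc j)) * real (q * s j) < drift n w - drift (n - q * s j) ((T ^^ (q * s j)) w)"
    (is "\<exists>\<^sub>\<infinity>n. ?P n")
    using good unfolding has_good_times_def by blast
  define S where "S n x = d x (u n w z0) - d z0 (u n w z0)" for n x
  \<comment> \<open>The triangle inequality confines all \<open>S n\<close> to one compact box
    independent of \<open>n\<close>.\<close>
  have box: "S n \<in> {h. \<forall>x. h x \<in> {- d z0 x..d z0 x}}" for n
    using pseudo_metricD(4)[OF d, of z0 "u n w z0"] pseudo_metricD(4)[OF d, of _ "u n w z0" z0]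
      pseudo_metricD(3)[OF d, of z0]
    by (auto simp: S_def algebra_simps)
  from frequently_cluster_point[where S = S, OF compact_pointwise_box box inf]
  obtain h where h: "\<And>m. h \<in> closure (S ` {n. m \<le> n \<and> ?P n})" by blast
  have "closure (S ` {n. 0 \<le> n \<and> ?P n}) \<subseteq> metric_functionals d z0"
    unfolding metric_functionals_def by (intro closure_mono) (auto simp: S_def[abs_def])
  with h[of 0] have "h \<in> metric_functionals d z0" by blast
  moreover have "(rate - inverse (Suc j)) * real (q * s j) \<le> - h (u (q * s j) w z0)"
    if q: "1 \<le> q" "K j \<le> q * s j" for j q
  proof -
    let ?k = "q * s j" and ?c = "- ((rate - inverse (Suc j)) * real (q * s j))"
    have "S n (u ?k w z0) \<le> ?c" if n: "?k \<le> n" and P: "?P n" for n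
    proof -
      have "S n (u ?k w z0) \<le> drift (n - ?k) ((T ^^ ?k) w) - drift n w"
        using dist_orbit_le[OF w n] pseudo_metricD(3)[OF d, of z0] by (simp add: S_def drift_def)
      moreover have "(rate - inverse (Suc j)) * real ?k < drift n w - drift (n - ?k) ((T ^^ ?k) w)"
        using P q n by blast
      ultimately show ?thesis by linarith
    qed
    then have "closure (S ` {n. ?k \<le> n \<and> ?P n}) \<subseteq> {h. h (u ?k w z0) \<le> ?c}"
      by (intro closure_minimal closed_functional_le) auto
    with h[of ?k] show ?thesis by auto
  qed
  ultimately show ?thesis using s by (intro that[of h s K])
qed

text \<open>The Lipschitz bound gives \<open>- h (u n w z0) \<le> drift n w\<close>, whence the
  upper estimate. The lower one is known at large multiples of \<open>s j\<close>, and rounding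
  \<open>n\<close> down to such a multiple costs o(n).\<close>

lemma functional_growth_base:
  assumes w: "w \<in> space M" and h: "h \<in> metric_functionals d z0" and s: "\<And>j. 1 \<le> s j"
    and low: "\<And>j q. 1 \<le> q \<Longrightarrow> K j \<le> q * s j \<Longrightarrow>
      (rate - inverse (Suc j)) * real (q * s j) \<le> - h (u (q * s j) w z0)"
    and upper: "\<And>c. rate < c \<Longrightarrow> \<forall>\<^sub>F n in sequentially. drift n w / n < c"
    and shift: "\<And>r. (\<lambda>n. drift r ((T ^^ (n - r)) w) / n) \<longlonglongrightarrow> 0"
  shows "(\<lambda>n. - h (u n w z0) / n) \<longlonglongrightarrow> rate" "(\<lambda>n. drift n w / n) \<longlonglongrightarrow> rate"
proof -
  have le: "- h (u n w z0) / n \<le> drift n w / n" for n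
    using metric_functional_lipschitz[OF d h, of z0 "u n w z0"] metric_functional_base[OF h]
      pseudo_metricD(3)[OF d, of z0]
    by (intro divide_right_mono) (auto simp: drift_def)
  have lower: "\<forall>\<^sub>F n in sequentially. a < - h (u n w z0) / n" if a: "a < rate" for a
  proof -
    obtain j where j: "inverse (real (Suc j)) < rate - a"
      using reals_Archimedean[of "rate - a"] a by auto
    define t where "t = rate - inverse (real (Suc j))"
    \<comment> \<open>The middle term pays for replacing \<open>n\<close> by \<open>q * s j\<close>,
      with an absolute value since \<open>t\<close> may be negative; the sum covers every possible
      remainder \<open>r\<close>.\<close>
    define b where "b n = t - (\<bar>t\<bar> * s j) / n - (\<Sum>r<s j. drift r ((T ^^ (n - r)) w) / n)" for n
    have "b \<longlonglongrightarrow> t - 0 - (\<Sum>r<s j. 0)"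
      unfolding b_def by (intro tendsto_intros shift lim_const_over_n)
    then have "\<forall>\<^sub>F n in sequentially. a < b n"
      using j by (intro order_tendstoD) (auto simp: t_def)
    then show ?thesis
      \<comment> \<open>The margin \<open>s j\<close> ensures \<open>1 \<le> q\<close> and
        \<open>K j \<le> q * s j\<close> after rounding down.\<close>
      using eventually_ge_at_top[of "K j + s j"]
    proof eventually_elim
      case (elim n)
      define q r where "q = n div s j" and "r = n mod s j"
      have r: "r < s j" using s[of j] by (simp add: r_def)
      have n: "n = q * s j + r" by (simp add: q_def r_def)
      have npos: "0 < n" using elim s[of j] by linarith
      have q: "1 \<le> q" using elim s[of j] by (simp add: q_def Suc_le_eq div_greater_zero_iff)
      have "t * real n - \<bar>t\<bar> * s j \<le> t * real (q * s j)"
      proof -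
        have "t * real n = t * real (q * s j) + t * real r"
          unfolding n by (simp add: distrib_left)
        moreover have "t * real r \<le> \<bar>t\<bar> * s j"
          using r by (intro mult_mono) auto
        ultimately show ?thesis by linarith
      qed
      also have "\<dots> \<le> - h (u (q * s j) w z0)"
        unfolding t_def using n r elim by (intro low q) linarith
      also have "\<dots> \<le> - h (u n w z0) + drift r ((T ^^ (n - r)) w)"
        using metric_functional_lipschitz[OF d h, of "u n w z0" "u (q * s j) w z0"]
          dist_orbit_le[OF w, of "q * s j" n] n pseudo_metricD(3)[OF d, of "u n w z0"] by simp
      also have "drift r ((T ^^ (n - r)) w) \<le> (\<Sum>r<s j. drift r ((T ^^ (n - r)) w))"
        using r by (intro member_le_sum) (auto intro: v_nonneg T_pow_space w)
      finally have "t * real n - \<bar>t\<bar> * s j - (\<Sum>r<s j. drift r ((T ^^ (n - r)) w)) \<le> - h (u n w z0)"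
        by simp
      then have "(t * real n - \<bar>t\<bar> * s j - (\<Sum>r<s j. drift r ((T ^^ (n - r)) w))) / n \<le> - h (u n w z0) / n"
        by (intro divide_right_mono) auto
      moreover have "(t * real n - \<bar>t\<bar> * s j - (\<Sum>r<s j. drift r ((T ^^ (n - r)) w))) / n = b n"
        using npos by (simp add: b_def diff_divide_distrib sum_divide_distrib)
      ultimately show ?case using elim by linarith
    qed
  qed
  show "(\<lambda>n. - h (u n w z0) / n) \<longlonglongrightarrow> rate"
  proof (rule order_tendstoI)
    fix c assume "rate < c"
    from upper[OF this] show "\<forall>\<^sub>F n in sequentially. - h (u n w z0) / n < c"
      by eventually_elim (rule le_less_trans[OF le])
  qed (rule lower)
  \<comment> \<open>The lower estimate for \<open>- h\<close> also bounds \<open>drift\<close> from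
    below, which completes Kingman's theorem for \<open>drift\<close>.\<close>
  show "(\<lambda>n. drift n w / n) \<longlonglongrightarrow> rate"
  proof (rule order_tendstoI)
    fix a assume "a < rate"
    from lower[OF this] show "\<forall>\<^sub>F n in sequentially. a < drift n w / n"
      by eventually_elim (rule less_le_trans[OF _ le])
  qed (rule upper)
qed

text \<open>Replacing \<open>z0\<close> by \<open>z\<close> changes both numerators by amounts
  bounded independently of \<open>n\<close>, so one \<open>h\<close> and the constant
  \<open>rate\<close> serve every \<open>z\<close>.\<close>

lemma AE_functional_growth:
  "AE w in M. \<exists>h \<in> metric_functionals d z0. \<forall>z.
     ((\<lambda>n. - h (u n w z) / real n) \<longlonglongrightarrow> rate) \<and>
     ((\<lambda>n. d (u n w z) z / real n) \<longlonglongrightarrow> rate)"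
  using AE_has_good_times AE_v_upper AE_v_shift_over_n AE_space
proof eventually_elim
  case (elim w)
  obtain h s K where h: "h \<in> metric_functionals d z0" and s: "\<And>j. 1 \<le> s j"
    and low: "\<And>j q. 1 \<le> q \<Longrightarrow> K j \<le> q * s j \<Longrightarrow>
      (rate - inverse (Suc j)) * real (q * s j) \<le> - h (u (q * s j) w z0)"
    using good_times_functional[OF elim(4,1)] by blast
  have lim: "(\<lambda>n. - h (u n w z0) / n) \<longlonglongrightarrow> rate" "(\<lambda>n. drift n w / n) \<longlonglongrightarrow> rate"
    using functional_growth_base[OF elim(4) h s low] elim(2,3) by blast+
  show ?case
  proof (intro bexI[OF _ h] allI conjI)
    fix z
    show "(\<lambda>n. - h (u n w z) / real n) \<longlonglongrightarrow> rate"
    proof (rule tendsto_over_n_bounded_diff[OF lim(1)])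
      fix n
      show "\<bar>- h (u n w z) - - h (u n w z0)\<bar> \<le> d z z0"
        using metric_functional_lipschitz[OF d h, of "u n w z" "u n w z0"]
          metric_functional_lipschitz[OF d h, of "u n w z0" "u n w z"]
          u_nonexp[OF elim(4), of n z z0] u_nonexp[OF elim(4), of n z0 z] pseudo_metricD(3)[OF d, of z0 z]
        by linarith
    qed
    show "(\<lambda>n. d (u n w z) z / real n) \<longlonglongrightarrow> rate"
    proof (rule tendsto_over_n_bounded_diff[OF lim(2)])
      fix n
      show "\<bar>d (u n w z) z - drift n w\<bar> \<le> 2 * d z z0"
        unfolding drift_def
        using pseudo_metricD(4)[OF d, of "u n w z" z "u n w z0"] pseudo_metricD(4)[OF d, of "u n w z0" z z0]
          pseudo_metricD(4)[OF d, of "u n w z0" z0 "u n w z"] pseudo_metricD(4)[OF d, of "u n w z" z0 z]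
          u_nonexp[OF elim(4), of n z z0] u_nonexp[OF elim(4), of n z0 z] pseudo_metricD(3)[OF d, of z0 z]
        by linarith
    qed
  qed
qed

end

theorem theorem5p1:
  fixes M :: "'w measure" and T :: "'w \<Rightarrow> 'w" and d :: "'z \<Rightarrow> 'z \<Rightarrow> real"
    and \<phi> :: "'w \<Rightarrow> 'z \<Rightarrow> 'z" and z0 :: 'z
  assumes "prob_space M"
    and "ergodic_map M T"
    and "pseudo_metric d"
    and nonexp: "\<forall>w\<in>space M. \<forall>x y. d (\<phi> w x) (\<phi> w y) \<le> d x y"
    and meas: "\<forall>z n. (\<lambda>w. cocycle T \<phi> n w z) \<in> M \<rightarrow>\<^sub>M pm_borel d"
    and integr: "\<exists>z. (\<integral>\<^sup>+ w. ennreal (d z (\<phi> w z)) \<partial>M) < \<infinity>"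
  shows "\<exists>\<tau>::real. AE w in M. \<exists>h \<in> metric_functionals d z0. \<forall>z.
           ((\<lambda>n. - h (cocycle T \<phi> n w z) / real n) \<longlonglongrightarrow> \<tau>) \<and>
           ((\<lambda>n. d (cocycle T \<phi> n w z) z / real n) \<longlonglongrightarrow> \<tau>)"
proof -
  interpret prob_space M by fact
  interpret nonexpansive_cocycle M T d \<phi> z0
    by unfold_locales (use assms in auto)
  show ?thesis
    using AE_functional_growth by (rule exI)
qed

end
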